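(* Let $l\in\mathbb Z_{\ge1}$ and let $\mathfrak z=\mathfrak z_D$ be a CM point, with $K$ and $q_{m,\mathfrak z}\in\mathcal O_K[t]$ as in the context. Then (i) the sequence $(q_{m,\mathfrak z}(0)\bmod l\mathcal O_K)_{m\ge0}$ is eventually periodic; (ii) if it is periodic from $m=\alpha$ on with (least) period $\beta$, then $\alpha+\beta\le l\,|\mathcal O_K/l\mathcal O_K|^{2l}$.
   Context: $D<0$ a fundamental discriminant, $\mathfrak z_D=\sqrt D/2$ ($D$ even) or $(1+\sqrt D)/2$ ($D$ odd). Attach $K$ and $a_1,\dots,a_4\in\mathcal O_K[t]$: if $D=-4$: $K=\mathbb Q$, $a_1=0$, $a_2=-2t$, $a_3=6(t^2-1)$, $a_4=-1$. If $D=-3$: $K=\mathbb Q$, $a_1=0$, $a_2=-2t^2$, $a_3=4(t^3-1)$, $a_4=-t$. If $D<-4$: with $E_2^*(z)=E_2(z)-3/(\pi\mathrm{Im}z)$, $Q=E_4$, $R=E_6$ (normalized Eisenstein series) and $\Omega_D=\frac1{\sqrt{2\pi|D|}}\big[\prod_{j=1}^{|D|-1}\Gamma(j/|D|)^{(D/j)}\big]^{1/(2h(D))}$, define $k_1,k_2,k_3$ by $E_2^*(\mathfrak z_D)=k_1|D|^{-1/2}\Omega_D^2$, $Q(\mathfrak z_D)=k_2\Omega_D^4$, $R(\mathfrak z_D)=k_3|D|^{1/2}\Omega_D^6$; $K$ is a number field containing them; $k_0\in\mathbb Z_{>0}$ with $k_0k_1,k_0k_2,k_0k_3|D|\in\mathcal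 O_K$; $m_1=k_0^2k_1k_2$, $m_2=k_0^2|D|k_3$ with common factors in $\mathbb Z_{>1}$ removed; $a_1=12k_0^4k_2m_1|D|(t+k_3)$, $a_2=2k_0^4k_2(m_1-m_2)|D|(t+k_3)$, $a_3=6k_0^4m_2(k_2|D|(t+k_3)^2-k_2^4)$, $a_4=-k_0^8k_2^5m_2(m_2-6m_1)|D|-k_0^8k_2^2m_1(4m_2+m_1)|D|^2(t+k_3)^2$. In all cases $q_{0,\mathfrak z}=1$, $q_{1,\mathfrak z}=a_1$, $q_{n+1,\mathfrak z}=(a_1+na_2)q_{n,\mathfrak z}+a_3q_{n,\mathfrak z}'+n(n+11)a_4q_{n-1,\mathfrak z}$ ($n\ge1$). *)

theory Defs
  imports
    "HOL-Analysis.Analysis"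
    "HOL-Computational_Algebra.Computational_Algebra"
    "HOL-Number_Theory.Residues"
begin

section \<open>Number fields inside the complex numbers\<close>

text \<open>
  A number field is a subfield of the complex numbers of finite degree over the rationals. The
  fields considered here contain prescribed complex numbers, so this is no loss of generality.
\<close>

definition number_field :: "complex set \<Rightarrow> bool" where
  "number_field K \<longleftrightarrow>
     0 \<in> K \<and> 1 \<in> K \<and>
     (\<forall>x\<in>K. \<forall>y\<in>K. x + y \<in> K \<and> x - y \<in> K \<and> x * y \<in> K) \<and> (\<forall>x\<in>K. inverse x \<in> K) \<and>
     (\<exists>B. finite B \<and> B \<subseteq> K \<and> (\<forall>x\<in>K. \<exists>c :: complex \<Rightarrow> rat. x = (\<Sum>b\<in>B. of_rat (c b) * b)))"

definition ring_of_ints :: "complex set \<Rightarrow> complex set" where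
  "ring_of_ints K = {x \<in> K. algebraic_int x}"

definition int_polys :: "complex set \<Rightarrow> complex poly set" where
  "int_polys K = {p. \<forall>i. Polynomial.coeff p i \<in> ring_of_ints K}"

text \<open>
  Congruence modulo the principal ideal generated by \<open>l\<close>, as an equivalence relation on the ring of
  integers. The residue ring is the set of its classes, and \<open>cong_rel K l `` {x}\<close> is the class of
  \<open>x\<close>.
\<close>

definition cong_rel :: "complex set \<Rightarrow> nat \<Rightarrow> (complex \<times> complex) set" where
  "cong_rel K l = {(x, y). x \<in> ring_of_ints K \<and> y \<in> ring_of_ints K \<and>
     (\<exists>w \<in> ring_of_ints K. x - y = of_nat l * w)}"

definition residue_ring_of_ints :: "complex set \<Rightarrow> nat \<Rightarrow> complex set set" where
  "residue_ring_of_ints K l = ring_of_ints K // cong_rel K l"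


section \<open>Discriminants, the Kronecker symbol and class numbers\<close>

definition fundamental_discriminant :: "int \<Rightarrow> bool" where
  "fundamental_discriminant D \<longleftrightarrow>
     D \<noteq> 1 \<and>
     (D mod 4 = 1 \<and> squarefree D \<or>
      (\<exists>m. D = 4 * m \<and> squarefree m \<and> (m mod 4 = 2 \<or> m mod 4 = 3)))"

definition kronecker_prime :: "int \<Rightarrow> nat \<Rightarrow> int" where
  "kronecker_prime D p =
     (if p = 2 then (if even D then 0 else if D mod 8 = 1 \<or> D mod 8 = 7 then 1 else -1)
      else Legendre D (int p))"

text \<open>The Kronecker symbol, for a positive second argument only.\<close>

definition kronecker :: "int \<Rightarrow> nat \<Rightarrow> int" where
  "kronecker D n = (\<Prod>p\<in>#prime_factorization n. kronecker_prime D p)"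

text \<open>
  The class number is the number of classes under the special linear group over the integers of
  primitive positive definite binary quadratic forms of discriminant \<open>D\<close>; the triple \<open>(a, b, c)\<close>
  stands for the form \<open>a x\<^sup>2 + b x y + c y\<^sup>2\<close>.
\<close>

fun qform :: "int \<times> int \<times> int \<Rightarrow> int \<Rightarrow> int \<Rightarrow> int" where
  "qform (a, b, c) x y = a * x\<^sup>2 + b * x * y + c * y\<^sup>2"

definition qforms :: "int \<Rightarrow> (int \<times> int \<times> int) set" where
  "qforms D = {(a, b, c). a > 0 \<and> gcd a (gcd b c) = 1 \<and> b\<^sup>2 - 4 * a * c = D}"

definition qform_equiv :: "int \<Rightarrow> ((int \<times> int \<times> int) \<times> (int \<times> int \<times> int)) set" where
  "qform_equiv D = {(f, g). f \<in> qforms D \<and> g \<in> qforms D \<and>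
     (\<exists>p q r s. p * s - q * r = 1 \<and>
        (\<forall>x y. qform g x y = qform f (p * x + q * y) (r * x + s * y)))}"

definition class_number :: "int \<Rightarrow> nat" where
  "class_number D = card (qforms D // qform_equiv D)"


section \<open>Eisenstein series and the CM period\<close>

definition divisor_sum :: "nat \<Rightarrow> nat \<Rightarrow> nat" where
  "divisor_sum k n = (\<Sum>d | d dvd n. d ^ k)"

definition eisenstein_series :: "complex \<Rightarrow> nat \<Rightarrow> complex \<Rightarrow> complex" where
  "eisenstein_series c k z =
     1 + c * (\<Sum>n. of_nat (divisor_sum k (Suc n)) * exp (2 * of_real pi * \<i> * z) ^ Suc n)"

definition E2 :: "complex \<Rightarrow> complex" where "E2 = eisenstein_series (-24) 1"
definition E4 :: "complex \<Rightarrow> complex" where "E4 = eisenstein_series 240 3"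
definition E6 :: "complex \<Rightarrow> complex" where "E6 = eisenstein_series (-504) 5"

definition E2_star :: "complex \<Rightarrow> complex" where
  "E2_star z = E2 z - of_real (3 / (pi * Im z))"

text \<open>For negative \<open>D\<close>, \<open>csqrt\<close> is the square root in the upper half plane.\<close>

definition cm_point :: "int \<Rightarrow> complex" where
  "cm_point D = (if even D then csqrt (of_int D) / 2 else (1 + csqrt (of_int D)) / 2)"

definition cm_period :: "int \<Rightarrow> real" where
  "cm_period D =
     1 / sqrt (2 * pi * of_int \<bar>D\<bar>) *
     (\<Prod>j = 1..nat \<bar>D\<bar> - 1. Gamma (real j / of_int \<bar>D\<bar>) powi kronecker D j)
       powr (1 / (2 * real (class_number D)))"


section \<open>The polynomials attached to a CM point\<close>

text \<open>
  \<open>remove_common K x y m1 m2\<close>: \<open>m1\<close> and \<open>m2\<close> arise from \<open>x\<close> and \<open>y\<close> by dividing out the largest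
  rational integer that divides both in the ring of integers of \<open>K\<close>.
\<close>

definition remove_common :: "complex set \<Rightarrow> complex \<Rightarrow> complex \<Rightarrow> complex \<Rightarrow> complex \<Rightarrow> bool" where
  "remove_common K x y m1 m2 \<longleftrightarrow>
     m1 \<in> ring_of_ints K \<and> m2 \<in> ring_of_ints K \<and>
     (\<exists>g::nat. g > 0 \<and> x = of_nat g * m1 \<and> y = of_nat g * m2) \<and>
     \<not> (\<exists>d::nat. d > 1 \<and> m1 / of_nat d \<in> ring_of_ints K \<and> m2 / of_nat d \<in> ring_of_ints K)"

text \<open>
  \<open>cm_data D K a1 a2 a3 a4\<close>: the field \<open>K\<close> and the polynomials \<open>a1, \<dots>, a4\<close> are attached to the
  discriminant \<open>D\<close>. In the generic case \<open>K\<close> and \<open>k0\<close> are not unique, so this is a relation. That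
  the polynomials are integral is part of the data; for the constant term of \<open>a3\<close> it is not a formal
  consequence of the integrality of \<open>k0 * k1\<close>, \<open>k0 * k2\<close> and \<open>k0 * k3 * \<bar>D\<bar>\<close>, but depends on the
  arithmetic of the CM values.
\<close>

inductive cm_data ::
  "int \<Rightarrow> complex set \<Rightarrow> complex poly \<Rightarrow> complex poly \<Rightarrow> complex poly \<Rightarrow> complex poly \<Rightarrow> bool" where
  minus_four: "cm_data (-4) \<rat> 0 [:0, -2:] [:-6, 0, 6:] [:-1:]"
| minus_three: "cm_data (-3) \<rat> 0 [:0, 0, -2:] [:-4, 0, 0, 4:] [:0, -1:]"
| generic: "cm_data D K a1 a2 a3 a4"
  if "D < -4" "number_field K"
    and "\<Omega> = complex_of_real (cm_period D)"
    and "\<delta> = complex_of_int \<bar>D\<bar>"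
    and "E2_star (cm_point D) = k1 * of_real (1 / sqrt (of_int \<bar>D\<bar>)) * \<Omega>^2"
    and "E4 (cm_point D) = k2 * \<Omega>^4"
    and "E6 (cm_point D) = k3 * of_real (sqrt (of_int \<bar>D\<bar>)) * \<Omega>^6"
    and "k1 \<in> K" "k2 \<in> K" "k3 \<in> K"
    and "k0 = complex_of_nat n0" "n0 > 0"
    and "k0 * k1 \<in> ring_of_ints K" "k0 * k2 \<in> ring_of_ints K" "k0 * k3 * \<delta> \<in> ring_of_ints K"
    and "remove_common K (k0^2 * k1 * k2) (k0^2 * \<delta> * k3) m1 m2"
    and "u = [:k3, 1:]"  \<comment> \<open>the polynomial \<open>t + k3\<close>\<close>
    and "a1 = [:12 * k0^4 * k2 * m1 * \<delta>:] * u"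
    and "a2 = [:2 * k0^4 * k2 * (m1 - m2) * \<delta>:] * u"
    and "a3 = [:6 * k0^4 * m2:] * ([:k2 * \<delta>:] * u^2 - [:k2^4:])"
    and "a4 = - [:k0^8 * k2^5 * m2 * (m2 - 6 * m1) * \<delta>:]
              - [:k0^8 * k2^2 * m1 * (4 * m2 + m1) * \<delta>^2:] * u^2"
    and "a1 \<in> int_polys K" "a2 \<in> int_polys K" "a3 \<in> int_polys K" "a4 \<in> int_polys K"

fun qpoly ::
  "complex poly \<Rightarrow> complex poly \<Rightarrow> complex poly \<Rightarrow> complex poly \<Rightarrow> nat \<Rightarrow> complex poly" where
  "qpoly a1 a2 a3 a4 0 = 1"
| "qpoly a1 a2 a3 a4 (Suc 0) = a1"
| "qpoly a1 a2 a3 a4 (Suc (Suc m)) =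
     (let n = Suc m in
        (a1 + of_nat n * a2) * qpoly a1 a2 a3 a4 n + a3 * pderiv (qpoly a1 a2 a3 a4 n)
        + of_nat (n * (n + 11)) * a4 * qpoly a1 a2 a3 a4 m)"


section \<open>Eventual periodicity\<close>

definition periodic_from :: "(nat \<Rightarrow> 'a) \<Rightarrow> nat \<Rightarrow> nat \<Rightarrow> bool" where
  "periodic_from s a p \<longleftrightarrow> p > 0 \<and> (\<forall>m\<ge>a. s (m + p) = s m)"

definition eventually_periodic :: "(nat \<Rightarrow> 'a) \<Rightarrow> bool" where
  "eventually_periodic s \<longleftrightarrow> (\<exists>a p. periodic_from s a p)"

text \<open>\<open>a\<close> is the first index from which \<open>s\<close> is periodic, and \<open>p\<close> is the least period from there.\<close>

definition preperiod_and_period :: "(nat \<Rightarrow> 'a) \<Rightarrow> nat \<Rightarrow> nat \<Rightarrow> bool" where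
  "preperiod_and_period s a p \<longleftrightarrow>
     periodic_from s a p \<and>
     (\<forall>a'<a. \<forall>p'. \<not> periodic_from s a' p') \<and>
     (\<forall>p'<p. \<not> periodic_from s a p')"

end

(* The ideal generated by l and t^l is stable under d/dt, so the recurrence descends to the
   polynomials over O_K / l modulo t^l. There the triple (n mod l, q_n, q_{n+1}) determines its
   successor, and it takes at most l * |O_K / l|^(2l) values; the first repetition among these states
   gives a preperiod and a period whose sum is at most that number. For the bound to make sense
   O_K / l has to be finite. *)

theory Submission
  imports Defs "Jordan_Normal_Form.Char_Poly"
begin

text \<open>The values at 0 modulo \<open>l\<close> do not form a closed system: the term with
  \<open>a3\<close> brings in the derivative, hence the next coefficient, and so on without end.
  Truncation stops this only at an exponent that differentiation respects, and \<open>t ^ l\<close>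
  qualifies because its derivative \<open>l * t ^ (l - 1)\<close> vanishes modulo \<open>l\<close>.
  The index enters the recurrence only through \<open>n\<close> and \<open>n * (n + 11)\<close>, so
  its residue suffices; the recurrence has order two, and two polynomials with \<open>l\<close>
  coefficients each account for the exponent \<open>2 * l\<close>. Most of the labour lies in the
  arithmetic of O_K, which is given merely as the set of algebraic integers in a finite-dimensional
  rational vector space. That it is a ring comes from integer matrices, and that its residue rings
  are finite comes from a rank bound at one prime at a time.\<close>

section \<open>Algebraic integers form a ring\<close>

text \<open>The span is that of an indexed family rather than of a set, because the products
  \<open>x ^ i * y ^ j\<close> to which it is applied may coincide for different exponents.\<close>

definition int_span :: "'i set \<Rightarrow> ('i \<Rightarrow> 'a::ring_1) \<Rightarrow> 'a set" where
  "int_span I v = range (\<lambda>c. \<Sum>i\<in>I. of_int (c i) * v i)"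

lemma int_spanI: "x = (\<Sum>i\<in>I. of_int (c i) * v i) \<Longrightarrow> x \<in> int_span I v"
  unfolding int_span_def by blast

lemma int_span_base:
  assumes "finite I" "i \<in> I"
  shows "v i \<in> int_span I v"
proof -
  have "v i = (\<Sum>j\<in>I. of_int (if j = i then 1 else 0) * v j)"
    using assms by (simp add: if_distrib[of of_int] if_distrib[of "\<lambda>x. x * _"] cong: if_cong)
  thus ?thesis by (rule int_spanI)
qed

lemma int_span_add:
  assumes "x \<in> int_span I v" "y \<in> int_span I v"
  shows "x + y \<in> int_span I v"
proof -
  from assms obtain c d where "x = (\<Sum>i\<in>I. of_int (c i) * v i)" "y = (\<Sum>i\<in>I. of_int (d i) * v i)"
    unfolding int_span_def by blast
  hence "x + y = (\<Sum>i\<in>I. of_int (c i + d i) * v i)"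
    by (simp add: sum.distrib distrib_right)
  thus ?thesis by (rule int_spanI)
qed

lemma int_span_scale:
  assumes "x \<in> int_span I v"
  shows "of_int k * x \<in> int_span I v"
proof -
  from assms obtain c where "x = (\<Sum>i\<in>I. of_int (c i) * v i)"
    unfolding int_span_def by blast
  hence "of_int k * x = (\<Sum>i\<in>I. of_int (k * c i) * v i)"
    by (simp add: sum_distrib_left mult.assoc)
  thus ?thesis by (rule int_spanI)
qed

lemma int_span_sum:
  assumes "\<And>j. j \<in> J \<Longrightarrow> f j \<in> int_span I v"
  shows "sum f J \<in> int_span I v"
proof -
  have "0 = (\<Sum>i\<in>I. of_int 0 * v i)"
    by simp
  hence "0 \<in> int_span I v"
    by (rule int_spanI)
  thus ?thesis
    using assms by (induction J rule: infinite_finite_induct) (auto intro: int_span_add)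
qed

text \<open>Stability on the generators extends by linearity. This is what allows two stabilizing
  multiplications to be composed.\<close>

lemma int_span_mult_closed:
  fixes x :: "'a :: comm_ring_1"
  assumes "\<And>i. i \<in> I \<Longrightarrow> x * v i \<in> int_span I v" and "y \<in> int_span I v"
  shows "x * y \<in> int_span I v"
proof -
  from assms(2) obtain c where "y = (\<Sum>i\<in>I. of_int (c i) * v i)"
    unfolding int_span_def by blast
  hence "x * y = (\<Sum>i\<in>I. of_int (c i) * (x * v i))"
    by (simp add: sum_distrib_left mult_ac)
  thus ?thesis using assms(1) by (auto intro!: int_span_sum int_span_scale)
qed

text \<open>The number \<open>x\<close> is an eigenvalue of an integer matrix, so the characteristic polynomial of
  that matrix witnesses its integrality.\<close>

lemma algebraic_int_if_stabilizes_int_span: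
  fixes x :: "'a :: field_char_0"
  assumes "finite I" and stable: "\<And>i. i \<in> I \<Longrightarrow> x * v i \<in> int_span I v"
    and "i0 \<in> I" "v i0 \<noteq> 0"
  shows "algebraic_int x"
proof -
  from stable have "\<forall>i\<in>I. \<exists>c. x * v i = (\<Sum>j\<in>I. of_int (c j) * v j)"
    unfolding int_span_def by blast
  then obtain c where c: "\<And>i. i \<in> I \<Longrightarrow> x * v i = (\<Sum>j\<in>I. of_int (c i j) * v j)"
    by metis
  define n where "n = card I"
  obtain h where h: "bij_betw h {0..<n} I"
    using ex_bij_betw_nat_finite[OF \<open>finite I\<close>] by (auto simp: n_def)
  define M where "M = Matrix.mat n n (\<lambda>(i, j). c (h i) (h j))"
  define w where "w = Matrix.vec n (\<lambda>i. v (h i))"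
  let ?M = "map_mat of_int M :: 'a Matrix.mat"
  have M: "M \<in> carrier_mat n n" by (simp add: M_def)
  have "?M *\<^sub>v w = x \<cdot>\<^sub>v w"
  proof (rule eq_vecI)
    fix i assume "i < dim_vec (x \<cdot>\<^sub>v w)"
    hence i: "i < n" by (simp add: w_def)
    have hi: "h i \<in> I" using h i by (auto simp: bij_betw_def)
    have "vec_index (?M *\<^sub>v w) i = (\<Sum>j = 0..<n. of_int (c (h i) (h j)) * v (h j))"
      using i by (simp add: M_def w_def scalar_prod_def)
    also have "\<dots> = (\<Sum>j\<in>I. of_int (c (h i) j) * v j)"
      by (rule sum.reindex_bij_betw[OF h])
    also have "\<dots> = vec_index (x \<cdot>\<^sub>v w) i"
      using c[OF hi] i by (simp add: w_def)
    finally show "vec_index (?M *\<^sub>v w) i = vec_index (x \<cdot>\<^sub>v w) i" .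
  qed (simp add: M_def w_def)
  moreover have "w \<noteq> 0\<^sub>v n"
  proof -
    from h \<open>i0 \<in> I\<close> obtain k where "k < n" "h k = i0"
      by (auto simp: bij_betw_def)
    hence "vec_index w k \<noteq> vec_index (0\<^sub>v n) k"
      using \<open>v i0 \<noteq> 0\<close> by (simp add: w_def)
    thus ?thesis by metis
  qed
  ultimately have "eigenvalue ?M x"
    using M unfolding eigenvalue_def eigenvector_def by (auto simp: w_def intro!: exI[of _ w])
  hence "poly (char_poly ?M) x = 0"
    using M by (subst (asm) eigenvalue_root_char_poly[of _ n]) auto
  moreover have "char_poly ?M = map_poly of_int (char_poly M)"
    by (rule of_int_hom.char_poly_hom[OF M])
  moreover have "lead_coeff (char_poly M) = 1"
    using degree_monic_char_poly[OF M] by simp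
  ultimately show ?thesis
    unfolding algebraic_int_altdef_ipoly by metis
qed

lemma algebraic_int_power_degree:
  fixes x :: "'a :: field_char_0"
  assumes "algebraic_int x"
  obtains m c where "m > 0" "x ^ m = (\<Sum>k<m. of_int (c k) * x ^ k)"
proof -
  from assms obtain p where p: "poly (map_poly of_int p) x = 0" "lead_coeff p = 1"
    unfolding algebraic_int_altdef_ipoly by blast
  define m where "m = degree p"
  have "0 = (\<Sum>k\<le>m. of_int (Polynomial.coeff p k) * x ^ k)"
    using p(1) by (simp add: poly_altdef m_def coeff_map_poly)
  also have "\<dots> = x ^ m + (\<Sum>k<m. of_int (Polynomial.coeff p k) * x ^ k)"
    using p(2) by (simp add: lessThan_Suc_atMost[symmetric] m_def)
  finally have eq: "x ^ m = - (\<Sum>k<m. of_int (Polynomial.coeff p k) * x ^ k)"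
    by (simp add: eq_neg_iff_add_eq_0)
  \<comment> \<open>For \<open>m = 0\<close> the relation would read \<open>1 = 0\<close>.\<close>
  have "m > 0"
    using eq by (cases m) auto
  moreover from eq have "x ^ m = (\<Sum>k<m. of_int (- Polynomial.coeff p k) * x ^ k)"
    by (simp add: sum_negf)
  ultimately show ?thesis by (rule that)
qed

text \<open>The monomials \<open>x ^ i * y ^ j\<close> with \<open>i < m\<close> and
  \<open>j < n\<close> span a group stable under both \<open>x\<close> and \<open>y\<close>: an
  exponent that reaches \<open>m\<close> or \<open>n\<close> is lowered again by the monic relation.
  The group is then stable under \<open>x + y\<close> and \<open>x * y\<close>, and it contains the
  nonzero element 1.\<close>

lemma algebraic_int_add_mult:
  fixes x y :: "'a :: field_char_0"
  assumes "algebraic_int x" "algebraic_int y"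
  shows algebraic_int_add: "algebraic_int (x + y)"
    and algebraic_int_mult: "algebraic_int (x * y)"
proof -
  obtain m c where m: "m > 0" "x ^ m = (\<Sum>k<m. of_int (c k) * x ^ k)"
    using algebraic_int_power_degree[OF assms(1)] by blast
  obtain n d where n: "n > 0" "y ^ n = (\<Sum>k<n. of_int (d k) * y ^ k)"
    using algebraic_int_power_degree[OF assms(2)] by blast
  define I where "I = {..<m} \<times> {..<n}"
  define v where "v = (\<lambda>(i, j). x ^ i * y ^ j)"
  have base: "x ^ i * y ^ j \<in> int_span I v" if "i < m" "j < n" for i j
    using int_span_base[of I "(i, j)" v] that by (simp add: I_def v_def)
  have x: "x * v z \<in> int_span I v" if z: "z \<in> I" for z
  proof -
    obtain i j where ij: "z = (i, j)" "i < m" "j < n"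
      using z by (auto simp: I_def)
    show ?thesis
    proof (cases "Suc i < m")
      case True
      thus ?thesis using base[of "Suc i" j] ij by (simp add: v_def mult_ac)
    next
      case False
      hence "x * v z = x ^ m * y ^ j"
        using ij by (simp add: v_def not_less less_Suc_eq_le flip: mult.assoc power_Suc)
          (metis le_antisym Suc_leI)
      also have "\<dots> = (\<Sum>k<m. of_int (c k) * (x ^ k * y ^ j))"
        by (simp add: m(2) sum_distrib_right mult.assoc)
      finally show ?thesis
        using base ij by (auto intro!: int_span_sum int_span_scale)
    qed
  qed
  have y: "y * v z \<in> int_span I v" if z: "z \<in> I" for z
  proof -
    obtain i j where ij: "z = (i, j)" "i < m" "j < n"
      using z by (auto simp: I_def)
    show ?thesis
    proof (cases "Suc j < n")
      case True
      thus ?thesis using base[of i "Suc j"] ij by (simp add: v_def mult_ac)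
    next
      case False
      hence "n = Suc j" using ij by simp
      hence "y * v z = x ^ i * y ^ n"
        using ij by (simp add: v_def mult_ac)
      also have "\<dots> = (\<Sum>k<n. of_int (d k) * (x ^ i * y ^ k))"
        by (simp add: n(2) sum_distrib_left mult_ac)
      finally show ?thesis
        using base ij by (auto intro!: int_span_sum int_span_scale)
    qed
  qed
  have "(0, 0) \<in> I" "v (0, 0) \<noteq> 0" "finite I"
    using m n by (auto simp: I_def v_def)
  moreover have "(x + y) * v z \<in> int_span I v" if "z \<in> I" for z
    using int_span_add[OF x[OF that] y[OF that]] by (simp add: distrib_right)
  moreover have "(x * y) * v z \<in> int_span I v" if "z \<in> I" for z
    using int_span_mult_closed[OF x y[OF that]] by (simp add: mult.assoc)
  ultimately show "algebraic_int (x + y)" "algebraic_int (x * y)"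
    using algebraic_int_if_stabilizes_int_span by metis+
qed


section \<open>Finiteness of residue rings\<close>

text \<open>Supplies linear algebra over \<rat>, in particular that an independent set is at most as
  large as a finite spanning set.\<close>

interpretation rat_scale: vector_space "\<lambda>(q :: rat) (x :: 'a :: field_char_0). of_rat q * x"
  by unfold_locales (auto simp: algebra_simps of_rat_add of_rat_mult)

lemma common_denominator:
  fixes u :: "'i \<Rightarrow> rat"
  assumes "finite S"
  shows "\<exists>d c. d \<noteq> 0 \<and> (\<forall>s\<in>S. of_int d * u s = of_int (c s))"
  using assms
proof (induction S rule: finite_induct)
  case empty
  thus ?case by (auto intro: exI[of _ 1])
next
  case (insert x S)
  then obtain d c where dc: "d \<noteq> 0" "\<And>s. s \<in> S \<Longrightarrow> of_int d * u s = of_int (c s)"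
    by blast
  obtain a b where ab: "b > 0" "u x = of_int a / of_int b"
    using quotient_of_div[of "u x"] quotient_of_denom_pos[of "u x"] by (metis surj_pair)
  have "of_int (d * b) * u s = of_int ((c(x := d * a)) s * (if s = x then 1 else b))"
    if "s \<in> insert x S" for s
    using that ab dc(2)[of s] by (auto simp: mult_ac)
  moreover have "d * b \<noteq> 0" using dc ab by simp
  ultimately show ?case
    by (intro exI[of _ "d * b"] exI[of _ "\<lambda>s. (c(x := d * a)) s * (if s = x then 1 else b)"]) blast
qed

text \<open>Infinite descent: all coefficients of a relation are divisible by \<open>p\<close>, and
  in characteristic zero the relation may be divided by \<open>p\<close>. Hence every power of
  \<open>p\<close> divides every coefficient.\<close>

lemma int_relation_trivial:
  fixes S :: "'a :: field_char_0 set"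
  assumes "p > (1::nat)" "finite S"
    and indep: "\<And>c. (\<Sum>s\<in>S. of_int (c s) * s) = 0 \<Longrightarrow> (\<forall>s\<in>S. int p dvd c s)"
    and "(\<Sum>s\<in>S. of_int (c s) * s) = 0" "s \<in> S"
  shows "c s = 0"
proof (rule ccontr)
  assume nz: "c s \<noteq> 0"
  have "\<forall>s\<in>S. int p ^ k dvd c s" if "(\<Sum>s\<in>S. of_int (c s) * s) = 0" for k c
    using that
  proof (induction k arbitrary: c)
    case (Suc k)
    have dvd: "\<forall>s\<in>S. int p dvd c s" using indep Suc.prems by blast
    have "of_nat p * (\<Sum>s\<in>S. of_int (c s div int p) * s) = (\<Sum>s\<in>S. of_int (c s) * s)"
      unfolding sum_distrib_left
    proof (rule sum.cong[OF refl])
      fix s assume "s \<in> S"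
      hence "c s = int p * (c s div int p)" using dvd by simp
      hence "(of_int (c s) :: 'a) = of_nat p * of_int (c s div int p)"
        by (metis of_int_mult of_int_of_nat_eq)
      thus "of_nat p * (of_int (c s div int p) * s) = of_int (c s) * s" by simp
    qed
    hence "(\<Sum>s\<in>S. of_int (c s div int p) * s) = 0"
      using Suc.prems assms(1) by simp
    from Suc.IH[OF this] dvd show ?case
      by (metis dvd_mult_div_cancel mult_dvd_mono dvd_refl power_Suc)
  qed simp
  \<comment> \<open>Since \<open>p ^ n > n\<close>, the exponent \<bar>c s\<bar> is already large
    enough to contradict \<open>c s \<noteq> 0\<close>.\<close>
  hence "int p ^ nat \<bar>c s\<bar> dvd c s" using assms by blast
  hence "\<bar>int p ^ nat \<bar>c s\<bar>\<bar> \<le> \<bar>c s\<bar>"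
    by (rule dvd_imp_le_int[OF nz])
  moreover have "nat \<bar>c s\<bar> < p ^ nat \<bar>c s\<bar>"
    using assms(1) by (simp add: power_gt_expt)
  hence "\<bar>c s\<bar> < int p ^ nat \<bar>c s\<bar>"
    by (metis abs_ge_zero int_nat_eq of_nat_less_iff of_nat_power)
  ultimately show False by simp
qed

text \<open>Clearing denominators in a rational dependence would give an integer relation with a
  nonzero coefficient, against the descent above. So \<open>S\<close> is independent over \<rat>,
  and its size is bounded by that of a spanning set.\<close>

lemma card_le_of_independent_mod:
  fixes S B :: "'a :: field_char_0 set"
  assumes "p > (1::nat)" "finite S" "finite B" "S \<subseteq> rat_scale.span B"
    and indep: "\<And>c. (\<Sum>s\<in>S. of_int (c s) * s) = 0 \<Longrightarrow> (\<forall>s\<in>S. int p dvd c s)"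
  shows "card S \<le> card B"
proof -
  have "\<not> rat_scale.dependent S"
  proof
    assume "rat_scale.dependent S"
    then obtain u t where u: "t \<in> S" "u t \<noteq> 0" "(\<Sum>s\<in>S. of_rat (u s) * s) = 0"
      using rat_scale.dependent_finite[OF \<open>finite S\<close>] by auto
    obtain d c where dc: "d \<noteq> 0" "\<And>s. s \<in> S \<Longrightarrow> of_int d * u s = of_int (c s)"
      using common_denominator[OF \<open>finite S\<close>] by blast
    have "(\<Sum>s\<in>S. of_int (c s) * s) = (\<Sum>s\<in>S. of_int d * (of_rat (u s) * s))"
    proof (rule sum.cong[OF refl])
      fix s assume "s \<in> S"
      hence "of_int d * of_rat (u s) = (of_int (c s) :: 'a)"
        using dc(2)[of s] by (metis of_rat_mult of_rat_of_int_eq)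
      thus "of_int (c s) * s = of_int d * (of_rat (u s) * s)" by (simp flip: mult.assoc)
    qed
    also have "\<dots> = 0" using u(3) by (simp flip: sum_distrib_left)
    finally have "c t = 0"
      using int_relation_trivial[OF assms(1,2) indep] u(1) by blast
    thus False using dc u by fastforce
  qed
  thus ?thesis
    using rat_scale.independent_span_bound[OF \<open>finite B\<close> _ assms(4)] by blast
qed

text \<open>A torsion-free abelian group \<open>A\<close> of finite rank need not be finitely generated, but
  \<open>A / p A\<close> has dimension at most the rank, because elements that are independent modulo
  \<open>p\<close> are independent over the rationals. So no discriminant is needed here.\<close>

lemma finite_residues_prime:
  fixes A B :: "'a :: field_char_0 set"
  assumes "prime p" "finite B" "A \<subseteq> rat_scale.span B"
    and zero: "0 \<in> A" and diff: "\<And>x y. x \<in> A \<Longrightarrow> y \<in> A \<Longrightarrow> x - y \<in> A"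
  shows "\<exists>T. finite T \<and> T \<subseteq> A \<and> (\<forall>x\<in>A. \<exists>t\<in>T. \<exists>w\<in>A. x = t + of_nat p * w)"
proof -
  have uminus: "- x \<in> A" if "x \<in> A" for x
    using diff[OF zero that] by simp
  have add: "x + y \<in> A" if "x \<in> A" "y \<in> A" for x y
    using diff[OF that(1) uminus[OF that(2)]] by simp
  have of_nat: "of_nat k * x \<in> A" if "x \<in> A" for k x
    by (induction k) (auto simp: zero distrib_right intro: add that)
  have scale: "of_int k * x \<in> A" if "x \<in> A" for k x
    using of_nat[OF that] uminus by (cases k rule: int_cases2) auto
  have lin: "(\<Sum>s\<in>S. of_int (c s) * s) \<in> A" if "S \<subseteq> A" for S c
    using that by (induction S rule: infinite_finite_induct) (auto simp: zero intro: add scale)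
  have p: "p > 1" using assms(1) by (rule prime_gt_1_nat)
  \<comment> \<open>Independence of the images in \<open>A / p A\<close> over the field with
    \<open>p\<close> elements, phrased with integer coefficients.\<close>
  define ind where "ind S \<longleftrightarrow> finite S \<and> S \<subseteq> A \<and>
    (\<forall>c. \<forall>w\<in>A. (\<Sum>s\<in>S. of_int (c s) * s) = of_nat p * w \<longrightarrow> (\<forall>s\<in>S. int p dvd c s))" for S
  have bound: "card S < Suc (card B)" if "ind S" for S
    unfolding less_Suc_eq_le
  proof (rule card_le_of_independent_mod[OF p])
    show "S \<subseteq> rat_scale.span B" using that assms(3) by (auto simp: ind_def)
    show "\<forall>s\<in>S. int p dvd c s" if "(\<Sum>s\<in>S. of_int (c s) * s) = 0" for c
      using that \<open>ind S\<close> zero unfolding ind_def by (metis mult_zero_right)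
  qed (use that assms in \<open>auto simp: ind_def\<close>)
  have "ind {}" by (simp add: ind_def)
  \<comment> \<open>The rank bounds the sizes, so an independent set of largest size exists; by
    maximality it also spans \<open>A\<close> modulo \<open>p A\<close>.\<close>
  then obtain S where S: "ind S" "\<And>S'. ind S' \<Longrightarrow> card S' \<le> card S"
    using ex_has_greatest_nat[of ind "{}" card "Suc (card B)"] bound by (metis less_imp_le)
  have fin: "finite S" and SA: "S \<subseteq> A" using S(1) by (auto simp: ind_def)
  have repr: "\<exists>c. \<exists>w\<in>A. x = (\<Sum>s\<in>S. of_int (c s) * s) + of_nat p * w" if x: "x \<in> A" for x
  proof (cases "x \<in> S")
    case True
    have "x = (\<Sum>s\<in>S. of_int (if s = x then 1 else 0) * s) + of_nat p * 0"
      using True fin by (simp add: if_distrib[of of_int] if_distrib[of "\<lambda>x. x * _"] cong: if_cong)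
    thus ?thesis
      using zero by (intro exI[of _ "\<lambda>s. if s = x then 1 else 0"] bexI[of _ 0]) auto
  next
    case False
    hence "\<not> ind (insert x S)"
      using S(2)[of "insert x S"] fin by auto
    then obtain c w t where w: "w \<in> A" "(\<Sum>s\<in>insert x S. of_int (c s) * s) = of_nat p * w"
      and t: "t \<in> insert x S" "\<not> int p dvd c t"
      using fin SA x unfolding ind_def by blast
    have eq: "of_int (c x) * x + (\<Sum>s\<in>S. of_int (c s) * s) = of_nat p * w"
      using w(2) False fin by simp
    \<comment> \<open>Otherwise the term of \<open>x\<close> could be moved into \<open>p A\<close>,
      leaving a relation within \<open>S\<close> alone.\<close>
    have "\<not> int p dvd c x"
    proof
      assume "int p dvd c x"
      then obtain k where k: "c x = int p * k" by blast
      have "(\<Sum>s\<in>S. of_int (c s) * s) = of_nat p * (w - of_int k * x)"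
        using eq by (simp add: k algebra_simps)
      moreover have "w - of_int k * x \<in> A" using w(1) x by (intro diff scale)
      ultimately have "\<forall>s\<in>S. int p dvd c s" using S(1) unfolding ind_def by blast
      thus False using t \<open>int p dvd c x\<close> by auto
    qed
    \<comment> \<open>Now \<open>c x\<close> is invertible modulo \<open>p\<close>, and Bezout
      coefficients solve the relation for \<open>x\<close>.\<close>
    hence "Rings.coprime (int p) (c x)"
      using assms(1) by (simp add: prime_imp_coprime)
    then obtain a b where ab: "a * c x + b * int p = 1"
      using bezout_int[of "c x" "int p"] by (auto simp: coprime_commute)
    have "x = of_int (a * c x + b * int p) * x" by (simp add: ab)
    also have "\<dots> = of_int a * (of_int (c x) * x) + of_nat p * (of_int b * x)"
      by (simp add: algebra_simps)
    also have "of_int (c x) * x = of_nat p * w - (\<Sum>s\<in>S. of_int (c s) * s)"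
      using eq by (simp add: algebra_simps)
    also have "of_int a * \<dots> + of_nat p * (of_int b * x) =
        (\<Sum>s\<in>S. of_int (- a * c s) * s) + of_nat p * (of_int a * w + of_int b * x)"
      by (simp add: algebra_simps sum_distrib_left sum_negf)
    finally show ?thesis
      using w(1) x by (intro exI[of _ "\<lambda>s. - a * c s"] bexI[of _ "of_int a * w + of_int b * x"])
        (auto intro!: add scale)
  qed
  \<comment> \<open>Only the coefficients modulo \<open>p\<close> matter; their quotients by
    \<open>p\<close> are absorbed into the summand from \<open>p A\<close>.\<close>
  define T where "T = (\<lambda>c. \<Sum>s\<in>S. of_int (c s) * s) ` (PiE S (\<lambda>_. {0..<int p}))"
  have "finite T" unfolding T_def using fin by (intro finite_imageI finite_PiE) auto
  moreover have "T \<subseteq> A" unfolding T_def using lin[OF SA] by auto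
  moreover have "\<exists>t\<in>T. \<exists>w\<in>A. x = t + of_nat p * w" if x: "x \<in> A" for x
  proof -
    obtain c w where w: "w \<in> A" "x = (\<Sum>s\<in>S. of_int (c s) * s) + of_nat p * w"
      using repr[OF x] by blast
    define r where "r = restrict (\<lambda>s. c s mod int p) S"
    have "(\<Sum>s\<in>S. of_int (c s) * s) =
        (\<Sum>s\<in>S. of_int (c s mod int p) * s + of_nat p * (of_int (c s div int p) * s))"
    proof (rule sum.cong[OF refl])
      fix s
      have "(of_int (c s) :: 'a) = of_int (c s mod int p + int p * (c s div int p))"
        by simp
      thus "of_int (c s) * s = of_int (c s mod int p) * s + of_nat p * (of_int (c s div int p) * s)"
        unfolding of_int_add of_int_mult of_int_of_nat_eq by (simp add: algebra_simps)
    qed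
    also have "\<dots> = (\<Sum>s\<in>S. of_int (r s) * s) + of_nat p * (\<Sum>s\<in>S. of_int (c s div int p) * s)"
      by (simp add: sum.distrib sum_distrib_left r_def)
    finally have "x = (\<Sum>s\<in>S. of_int (r s) * s) +
        of_nat p * ((\<Sum>s\<in>S. of_int (c s div int p) * s) + w)"
      by (simp add: w(2) algebra_simps)
    moreover have "(\<Sum>s\<in>S. of_int (r s) * s) \<in> T"
      unfolding T_def using p by (intro imageI) (auto simp: r_def)
    moreover have "(\<Sum>s\<in>S. of_int (c s div int p) * s) + w \<in> A"
      using lin[OF SA] w(1) by (intro add)
    ultimately show ?thesis by blast
  qed
  ultimately show ?thesis by blast
qed

text \<open>Induction over the prime factors of \<open>l\<close>, repeated ones included: in
  \<open>x = t + p * w\<close> the cofactor \<open>w\<close> is reduced modulo \<open>l\<close> in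
  turn, so the numbers \<open>t + p * u\<close> represent \<open>A\<close> modulo
  \<open>p * l\<close>.\<close>

lemma finite_residues:
  fixes A B :: "'a :: field_char_0 set"
  assumes "finite B" "A \<subseteq> rat_scale.span B"
    and zero: "0 \<in> A" and diff: "\<And>x y. x \<in> A \<Longrightarrow> y \<in> A \<Longrightarrow> x - y \<in> A"
    and "l > 0"
  shows "\<exists>T. finite T \<and> T \<subseteq> A \<and> (\<forall>x\<in>A. \<exists>t\<in>T. \<exists>w\<in>A. x = t + of_nat l * w)"
  using \<open>l > 0\<close>
proof (induction l rule: prime_divisors_induct)
  case (unit l)
  hence "\<forall>x\<in>A. \<exists>t\<in>{0}. \<exists>w\<in>A. x = t + of_nat l * w" by auto
  thus ?case using zero by (intro exI[of _ "{0}"]) auto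
next
  case (factor p l)
  have uminus: "- x \<in> A" if "x \<in> A" for x
    using diff[OF zero that] by simp
  have add: "x + y \<in> A" if "x \<in> A" "y \<in> A" for x y
    using diff[OF that(1) uminus[OF that(2)]] by simp
  have of_nat: "of_nat k * x \<in> A" if "x \<in> A" for k x
    by (induction k) (auto simp: zero distrib_right intro: add that)
  obtain T where T: "finite T" "T \<subseteq> A" "\<And>x. x \<in> A \<Longrightarrow> \<exists>t\<in>T. \<exists>w\<in>A. x = t + of_nat p * w"
    using finite_residues_prime[OF \<open>prime p\<close> assms(1-4)] by blast
  obtain U where U: "finite U" "U \<subseteq> A" "\<And>x. x \<in> A \<Longrightarrow> \<exists>t\<in>U. \<exists>w\<in>A. x = t + of_nat l * w"
    using factor by auto
  define V where "V = (\<lambda>(t, u). t + of_nat p * u) ` (T \<times> U)"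
  have "finite V" using T U by (simp add: V_def)
  moreover have "V \<subseteq> A" using T(2) U(2) by (auto simp: V_def intro!: add of_nat)
  moreover have "\<exists>t\<in>V. \<exists>w\<in>A. x = t + of_nat (p * l) * w" if x: "x \<in> A" for x
  proof -
    obtain t w where t: "t \<in> T" "w \<in> A" "x = t + of_nat p * w" using T(3)[OF x] by blast
    obtain u z where u: "u \<in> U" "z \<in> A" "w = u + of_nat l * z" using U(3)[OF t(2)] by blast
    have "x = (t + of_nat p * u) + of_nat (p * l) * z" by (simp add: t(3) u(3) algebra_simps)
    moreover have "t + of_nat p * u \<in> V" using t(1) u(1) by (auto simp: V_def)
    ultimately show ?thesis using u(2) by blast
  qed
  ultimately show ?case by blast
qed simp

section \<open>Rings of integers of number fields and their residue classes\<close>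

lemma number_field_Rats: "number_field \<rat>"
proof -
  have "\<forall>x\<in>\<rat>. \<exists>c :: complex \<Rightarrow> rat. x = (\<Sum>b\<in>{1}. of_rat (c b) * b)"
  proof
    fix x :: complex assume "x \<in> \<rat>"
    then obtain r where "x = of_rat r" by (rule Rats_cases)
    thus "\<exists>c :: complex \<Rightarrow> rat. x = (\<Sum>b\<in>{1}. of_rat (c b) * b)"
      by (intro exI[of _ "\<lambda>_. r"]) simp
  qed
  hence "\<exists>B. finite B \<and> B \<subseteq> \<rat> \<and> (\<forall>x\<in>\<rat>. \<exists>c :: complex \<Rightarrow> rat. x = (\<Sum>b\<in>B. of_rat (c b) * b))"
    by (intro exI[of _ "{1}"]) simp
  thus ?thesis
    unfolding number_field_def by simp
qed

lemma ring_of_ints_closed: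
  assumes "number_field K"
  shows ring_of_ints_of_nat: "of_nat n \<in> ring_of_ints K"
    and ring_of_ints_add: "x \<in> ring_of_ints K \<Longrightarrow> y \<in> ring_of_ints K \<Longrightarrow> x + y \<in> ring_of_ints K"
    and ring_of_ints_mult: "x \<in> ring_of_ints K \<Longrightarrow> y \<in> ring_of_ints K \<Longrightarrow> x * y \<in> ring_of_ints K"
    and ring_of_ints_uminus: "x \<in> ring_of_ints K \<Longrightarrow> - x \<in> ring_of_ints K"
    and ring_of_ints_diff: "x \<in> ring_of_ints K \<Longrightarrow> y \<in> ring_of_ints K \<Longrightarrow> x - y \<in> ring_of_ints K"
proof -
  have K: "0 \<in> K" "1 \<in> K" "\<And>x y. x \<in> K \<Longrightarrow> y \<in> K \<Longrightarrow> x + y \<in> K"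
    "\<And>x y. x \<in> K \<Longrightarrow> y \<in> K \<Longrightarrow> x - y \<in> K" "\<And>x y. x \<in> K \<Longrightarrow> y \<in> K \<Longrightarrow> x * y \<in> K"
    using assms unfolding number_field_def by auto
  have "of_nat n \<in> K"
    by (induction n) (auto intro: K)
  thus "of_nat n \<in> ring_of_ints K"
    by (simp add: ring_of_ints_def)
  show "x \<in> ring_of_ints K \<Longrightarrow> y \<in> ring_of_ints K \<Longrightarrow> x + y \<in> ring_of_ints K"
    "x \<in> ring_of_ints K \<Longrightarrow> y \<in> ring_of_ints K \<Longrightarrow> x * y \<in> ring_of_ints K"
    by (simp_all add: ring_of_ints_def K algebraic_int_add_mult)
  show "x \<in> ring_of_ints K \<Longrightarrow> - x \<in> ring_of_ints K"
    using K(4)[OF K(1), of x] by (simp add: ring_of_ints_def)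
  show "x \<in> ring_of_ints K \<Longrightarrow> y \<in> ring_of_ints K \<Longrightarrow> x - y \<in> ring_of_ints K"
    using algebraic_int_add[of x "- y"] by (simp add: ring_of_ints_def K)
qed

lemma equiv_cong_rel:
  assumes "number_field K"
  shows "equiv (ring_of_ints K) (cong_rel K l)"
proof (rule equivI)
  note closed = ring_of_ints_closed[OF assms]
  show "cong_rel K l \<subseteq> ring_of_ints K \<times> ring_of_ints K"
    by (auto simp: cong_rel_def)
  show "refl_on (ring_of_ints K) (cong_rel K l)"
    using closed(1)[of 0] by (auto simp: refl_on_def cong_rel_def intro: bexI[of _ 0])
  show "sym (cong_rel K l)"
    unfolding sym_def cong_rel_def
  proof (clarsimp, intro bexI)
    fix x y w :: complex assume "x - y = of_nat l * w"
    thus "y - x = of_nat l * (- w)" by (simp add: algebra_simps)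
  qed (rule closed)
  show "trans (cong_rel K l)"
    unfolding trans_def cong_rel_def
  proof (clarsimp, intro bexI)
    fix x y z v w :: complex assume "x - y = of_nat l * v" "y - z = of_nat l * w"
    thus "x - z = of_nat l * (v + w)" by (simp add: algebra_simps)
  qed (rule closed)
qed

text \<open>The ring of integers enters as an additive subgroup of the rational span of a finite
  set, to which the general finiteness result applies.\<close>

lemma finite_residue_ring_of_ints:
  assumes "number_field K" "l > 0"
  shows "finite (residue_ring_of_ints K l)"
proof -
  let ?O = "ring_of_ints K"
  obtain B where B: "finite B" "\<And>x. x \<in> K \<Longrightarrow> \<exists>c :: complex \<Rightarrow> rat. x = (\<Sum>b\<in>B. of_rat (c b) * b)"
    using assms(1) unfolding number_field_def by blast
  have "?O \<subseteq> rat_scale.span B"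
  proof
    fix x assume "x \<in> ?O"
    then obtain c :: "complex \<Rightarrow> rat" where x: "x = (\<Sum>b\<in>B. of_rat (c b) * b)"
      using B(2)[of x] by (auto simp: ring_of_ints_def)
    thus "x \<in> rat_scale.span B"
      unfolding x by (intro rat_scale.span_sum rat_scale.span_scale rat_scale.span_base)
  qed
  then obtain T where T: "finite T" "T \<subseteq> ?O"
      "\<And>x. x \<in> ?O \<Longrightarrow> \<exists>t\<in>T. \<exists>w\<in>?O. x = t + of_nat l * w"
    using finite_residues[OF B(1) _ _ ring_of_ints_diff[OF assms(1)] assms(2)]
      ring_of_ints_of_nat[OF assms(1), of 0] by (metis of_nat_0)
  have "residue_ring_of_ints K l \<subseteq> (\<lambda>t. cong_rel K l `` {t}) ` T"
  proof
    fix X assume "X \<in> residue_ring_of_ints K l"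
    then obtain x where x: "x \<in> ?O" "X = cong_rel K l `` {x}"
      unfolding residue_ring_of_ints_def by (rule quotientE)
    obtain t w where t: "t \<in> T" "w \<in> ?O" "x = t + of_nat l * w" using T(3)[OF x(1)] by blast
    hence "(x, t) \<in> cong_rel K l" using x(1) T(2) by (auto simp: cong_rel_def)
    hence "X = cong_rel K l `` {t}"
      using equiv_class_eq[OF equiv_cong_rel[OF assms(1)]] x(2) by simp
    thus "X \<in> (\<lambda>t. cong_rel K l `` {t}) ` T" using t(1) by blast
  qed
  thus ?thesis using T(1) finite_surj by blast
qed


section \<open>Polynomials modulo \<open>l\<close> and \<open>t ^ l\<close>\<close>

lemma cong_rel_add:
  assumes "number_field K" "(x, x') \<in> cong_rel K l" "(y, y') \<in> cong_rel K l"
  shows "(x + y, x' + y') \<in> cong_rel K l"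
proof -
  from assms(2,3) obtain v w where "v \<in> ring_of_ints K" "w \<in> ring_of_ints K"
    "x - x' = of_nat l * v" "y - y' = of_nat l * w"
    unfolding cong_rel_def by blast
  moreover from this have "(x + y) - (x' + y') = of_nat l * (v + w)"
    by (simp add: algebra_simps)
  ultimately show ?thesis
    using assms(2,3) ring_of_ints_add[OF assms(1)] unfolding cong_rel_def by blast
qed

lemma cong_rel_mult:
  assumes "number_field K" "(x, x') \<in> cong_rel K l" "(y, y') \<in> cong_rel K l"
  shows "(x * y, x' * y') \<in> cong_rel K l"
proof -
  from assms(2,3) obtain v w where "v \<in> ring_of_ints K" "w \<in> ring_of_ints K"
    "x - x' = of_nat l * v" "y - y' = of_nat l * w"
    unfolding cong_rel_def by blast
  \<comment> \<open>From \<open>x * y - x' * y' = (x - x') * y + x' * (y - y')\<close>.\<close>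
  moreover from this have "x * y - x' * y' = of_nat l * (v * y + x' * w)"
    by (simp add: algebra_simps flip: right_diff_distrib)
  ultimately show ?thesis
    using assms(2,3) ring_of_ints_add[OF assms(1)] ring_of_ints_mult[OF assms(1)]
    by (auto simp: cong_rel_def intro!: bexI[of _ "v * y + x' * w"])
qed

lemma cong_rel_refl:
  assumes "number_field K" "x \<in> ring_of_ints K"
  shows "(x, x) \<in> cong_rel K l"
  using equiv_cong_rel[OF assms(1)] assms(2) by (auto simp: equiv_def refl_on_def)

lemma cong_rel_sum:
  assumes "number_field K" "\<And>i. i \<in> I \<Longrightarrow> (f i, g i) \<in> cong_rel K l"
  shows "(sum f I, sum g I) \<in> cong_rel K l"
  using assms(2) cong_rel_refl[OF assms(1) ring_of_ints_of_nat[OF assms(1), of 0]]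
  by (induction I rule: infinite_finite_induct) (auto intro: cong_rel_add[OF assms(1)])

text \<open>Used for the integer factors of the recurrence. Both numbers are compared with their
  common remainder, which avoids a case distinction on the sign of \<open>a - b\<close>.\<close>

lemma cong_rel_of_nat:
  assumes "number_field K" "a mod l = b mod l"
  shows "(of_nat a, of_nat b) \<in> cong_rel K l"
proof -
  have mod: "(of_nat c, of_nat (c mod l)) \<in> cong_rel K l" for c
  proof -
    have "(of_nat c :: complex) = of_nat (l * (c div l) + c mod l)"
      by simp
    hence "of_nat c - of_nat (c mod l) = (of_nat l * of_nat (c div l) :: complex)"
      unfolding of_nat_add of_nat_mult by simp
    thus ?thesis
      unfolding cong_rel_def using ring_of_ints_of_nat[OF assms(1)] by blast
  qed
  show ?thesis
    using mod[of a] mod[of b] assms(2) equiv_cong_rel[OF assms(1), of l]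
    unfolding equiv_def by (metis symD transD)
qed

text \<open>Congruence modulo the ideal generated by \<open>l\<close> and \<open>t ^ l\<close>, read
  off from the coefficients below \<open>l\<close>. Integrality is demanded of all coefficients
  because differentiation brings in the coefficient of index \<open>l\<close>.\<close>

definition poly_cong :: "complex set \<Rightarrow> nat \<Rightarrow> complex poly \<Rightarrow> complex poly \<Rightarrow> bool" where
  "poly_cong K l p q \<longleftrightarrow> p \<in> int_polys K \<and> q \<in> int_polys K \<and>
     (\<forall>i<l. (Polynomial.coeff p i, Polynomial.coeff q i) \<in> cong_rel K l)"

lemma int_polys_closed:
  assumes "number_field K"
  shows int_polys_of_nat: "of_nat n \<in> int_polys K"
    and int_polys_add: "p \<in> int_polys K \<Longrightarrow> q \<in> int_polys K \<Longrightarrow> p + q \<in> int_polys K"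
    and int_polys_mult: "p \<in> int_polys K \<Longrightarrow> q \<in> int_polys K \<Longrightarrow> p * q \<in> int_polys K"
    and int_polys_pderiv: "p \<in> int_polys K \<Longrightarrow> pderiv p \<in> int_polys K"
proof -
  note closed = ring_of_ints_closed[OF assms]
  have zero: "0 \<in> ring_of_ints K" using closed(1)[of 0] by simp
  have sum: "sum f I \<in> ring_of_ints K" if "\<And>i. i \<in> I \<Longrightarrow> f i \<in> ring_of_ints K"
    for f :: "nat \<Rightarrow> complex" and I
    using that by (induction I rule: infinite_finite_induct) (auto intro: closed zero)
  show "of_nat n \<in> int_polys K"
    using closed(1)[of n] zero by (auto simp: int_polys_def of_nat_poly coeff_pCons split: nat.split)
  show "p \<in> int_polys K \<Longrightarrow> q \<in> int_polys K \<Longrightarrow> p + q \<in> int_polys K"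
    "p \<in> int_polys K \<Longrightarrow> q \<in> int_polys K \<Longrightarrow> p * q \<in> int_polys K"
    by (auto simp: int_polys_def coeff_mult intro!: closed sum)
  show "p \<in> int_polys K \<Longrightarrow> pderiv p \<in> int_polys K"
    by (simp add: int_polys_def coeff_pderiv closed del: of_nat_Suc)
qed

lemma poly_cong_refl:
  assumes "number_field K" "p \<in> int_polys K"
  shows "poly_cong K l p p"
  using assms by (simp add: poly_cong_def int_polys_def cong_rel_refl)

lemma poly_cong_add:
  assumes "number_field K" "poly_cong K l p p'" "poly_cong K l q q'"
  shows "poly_cong K l (p + q) (p' + q')"
  using assms by (simp add: poly_cong_def cong_rel_add int_polys_add)

text \<open>A coefficient of index \<open>i < l\<close> of the product involves only coefficients of
  index at most \<open>i\<close> of the factors.\<close>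

lemma poly_cong_mult:
  assumes "number_field K" "poly_cong K l p p'" "poly_cong K l q q'"
  shows "poly_cong K l (p * q) (p' * q')"
  using assms(2,3) unfolding poly_cong_def coeff_mult
  by (intro conjI allI impI cong_rel_sum cong_rel_mult int_polys_mult assms(1)) auto

lemma poly_cong_of_nat:
  assumes "number_field K" "a mod l = b mod l"
  shows "poly_cong K l (of_nat a) (of_nat b)"
proof -
  have "(Polynomial.coeff (of_nat a) i, Polynomial.coeff (of_nat b) i) \<in> cong_rel K l" for i
    using cong_rel_of_nat[OF assms] cong_rel_of_nat[OF assms(1), of 0 l 0]
    by (simp add: of_nat_poly coeff_pCons split: nat.split)
  thus ?thesis
    using int_polys_of_nat[OF assms(1)] by (simp add: poly_cong_def)
qed

text \<open>The coefficient of \<open>t ^ (l - 1)\<close> in the derivative involves the coefficient of \<open>t ^ l\<close>, which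
  is not controlled, but it appears multiplied by \<open>l\<close>.\<close>

lemma poly_cong_pderiv:
  assumes "number_field K" "poly_cong K l p q"
  shows "poly_cong K l (pderiv p) (pderiv q)"
proof -
  have int: "Polynomial.coeff p i \<in> ring_of_ints K" "Polynomial.coeff q i \<in> ring_of_ints K" for i
    using assms(2) by (auto simp: poly_cong_def int_polys_def)
  have "(of_nat (Suc i) * Polynomial.coeff p (Suc i), of_nat (Suc i) * Polynomial.coeff q (Suc i))
      \<in> cong_rel K l" if "i < l" for i
  proof (cases "Suc i < l")
    case True
    thus ?thesis using assms(2)
      by (intro cong_rel_mult cong_rel_of_nat) (auto simp: poly_cong_def assms(1))
  next
    case False
    hence l: "l = Suc i" using that by simp
    show ?thesis
      unfolding cong_rel_def using int[of "Suc i"] ring_of_ints_closed[OF assms(1)]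
      by (auto simp: l simp del: of_nat_Suc simp flip: right_diff_distrib
          intro!: bexI[of _ "Polynomial.coeff p (Suc i) - Polynomial.coeff q (Suc i)"])
  qed
  thus ?thesis
    using assms(2) int_polys_pderiv[OF assms(1)]
    by (auto simp: poly_cong_def coeff_pderiv simp del: of_nat_Suc)
qed

text \<open>Turns the congruence into equality of functions that are restricted to
  \<open>{..<l}\<close>, so that the classes can be counted as elements of a finite
  \<open>PiE\<close>.\<close>

lemma poly_cong_trunc_eq_iff:
  assumes "number_field K" "p \<in> int_polys K" "q \<in> int_polys K"
  shows "(\<lambda>i\<in>{..<l}. cong_rel K l `` {Polynomial.coeff p i}) =
         (\<lambda>i\<in>{..<l}. cong_rel K l `` {Polynomial.coeff q i}) \<longleftrightarrow> poly_cong K l p q"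
proof -
  have "cong_rel K l `` {Polynomial.coeff p i} = cong_rel K l `` {Polynomial.coeff q i} \<longleftrightarrow>
      (Polynomial.coeff p i, Polynomial.coeff q i) \<in> cong_rel K l" for i
    using eq_equiv_class_iff[OF equiv_cong_rel[OF assms(1)]] assms(2,3)
    by (auto simp: int_polys_def)
  thus ?thesis
    using assms(2,3) by (auto simp: poly_cong_def fun_eq_iff restrict_def)
qed


section \<open>Eventual periodicity\<close>

text \<open>The index \<open>a\<close> may exceed \<alpha>, so \<open>p\<close> has to be shown to
  be a period from \<alpha> on before minimality of \<beta> applies: move forward by a multiple of
  \<beta>, use \<open>p\<close> there, and move back.\<close>

lemma least_period_le:
  assumes "preperiod_and_period s \<alpha> \<beta>" "periodic_from s a p"
  shows "\<alpha> \<le> a" "\<beta> \<le> p"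
proof -
  have \<beta>: "\<beta> > 0" "\<And>m. m \<ge> \<alpha> \<Longrightarrow> s (m + \<beta>) = s m"
    using assms(1) by (auto simp: preperiod_and_period_def periodic_from_def)
  show "\<alpha> \<le> a"
    using assms by (auto simp: preperiod_and_period_def not_less[symmetric])
  have shift: "s (m + k * \<beta>) = s m" if "m \<ge> \<alpha>" for m k
  proof (induction k)
    case (Suc k)
    thus ?case using \<beta>(2)[of "m + k * \<beta>"] that by (simp add: add_ac)
  qed simp
  have "s (m + p) = s m" if "m \<ge> \<alpha>" for m
  proof -
    \<comment> \<open>As \<beta> is positive, \<open>a\<close> steps of length \<beta> reach beyond
      \<open>a\<close>.\<close>
    have "s (m + p) = s ((m + a * \<beta>) + p)"
      using shift[of "m + p" a] that by (simp add: add_ac)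
    also have "m + a * \<beta> \<ge> a" using \<beta>(1) by (simp add: trans_le_add2)
    hence "s ((m + a * \<beta>) + p) = s (m + a * \<beta>)"
      using assms(2) by (simp add: periodic_from_def)
    finally show ?thesis using shift[OF that] by simp
  qed
  hence "periodic_from s \<alpha> p" using assms(2) by (simp add: periodic_from_def)
  thus "\<beta> \<le> p" using assms(1) by (auto simp: preperiod_and_period_def not_less[symmetric])
qed

text \<open>Among the \<open>card X + 1\<close> states with index at most \<open>card X\<close> two
  coincide, at \<open>i < j\<close>. The preperiod \<open>i\<close> and the period
  \<open>j - i\<close> add up to \<open>j\<close>, hence to at most \<open>card X\<close>.\<close>

lemma finite_state_periodic:
  fixes \<sigma> :: "nat \<Rightarrow> 'b"
  assumes "finite X" "\<And>n. \<sigma> n \<in> X"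
    and step: "\<And>m n. \<sigma> m = \<sigma> n \<Longrightarrow> \<sigma> (Suc m) = \<sigma> (Suc n)"
    and out: "\<And>m n. \<sigma> m = \<sigma> n \<Longrightarrow> s m = s n"
  shows "\<exists>a p. periodic_from s a p \<and> a + p \<le> card X"
proof -
  have "\<not> inj_on \<sigma> {..card X}"
  proof
    assume "inj_on \<sigma> {..card X}"
    hence "card {..card X} \<le> card X"
      using assms(1,2) by (intro card_inj_on_le[of \<sigma>]) auto
    thus False by simp
  qed
  then obtain i j where ij: "i < j" "j \<le> card X" "\<sigma> i = \<sigma> j"
    unfolding inj_on_def by (metis atMost_iff nat_neq_iff)
  have "\<sigma> (j + k) = \<sigma> (i + k)" for k
    by (induction k) (auto simp: ij(3) intro: step)
  hence repeat: "\<sigma> (m + (j - i)) = \<sigma> m" if "m \<ge> i" for m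
    using that ij(1) by (metis add.commute add_diff_inverse_nat diff_add_assoc less_imp_le not_less)
  have "s (m + (j - i)) = s m" if "m \<ge> i" for m
    by (rule out[OF repeat[OF that]])
  hence "periodic_from s i (j - i)"
    using ij(1) by (simp add: periodic_from_def)
  thus ?thesis using ij by (intro exI[of _ i] exI[of _ "j - i"]) auto
qed

section \<open>The recurrence modulo \<open>l\<close> and \<open>t ^ l\<close>\<close>

lemma cm_data_integral:
  assumes "cm_data D K a1 a2 a3 a4"
  shows "number_field K" "a1 \<in> int_polys K" "a2 \<in> int_polys K" "a3 \<in> int_polys K" "a4 \<in> int_polys K"
  using assms
  \<comment> \<open>In the generic case the claims are premises of the rule; for -4 and -3 the field
    is \<rat> and all coefficients are rational integers.\<close>
  by (cases; auto simp: number_field_Rats int_polys_def ring_of_ints_def coeff_pCons split: nat.split)+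

lemma qpoly_int:
  assumes "number_field K" "a1 \<in> int_polys K" "a2 \<in> int_polys K" "a3 \<in> int_polys K" "a4 \<in> int_polys K"
  shows "qpoly a1 a2 a3 a4 n \<in> int_polys K"
  using int_polys_of_nat[OF assms(1), of 1, simplified]
  by (induction n rule: induct_nat_012)
    (auto simp: Let_def assms simp del: of_nat_Suc of_nat_mult of_nat_add
      intro!: int_polys_closed[OF assms(1)])

text \<open>The factors \<open>Suc m\<close> and \<open>Suc m * (Suc m + 11)\<close> depend modulo
  \<open>l\<close> only on \<open>m mod l\<close>; the rest of the recurrence is built from
  operations compatible with the congruence.\<close>

lemma poly_cong_qpoly_step:
  assumes K: "number_field K"
    and a: "a1 \<in> int_polys K" "a2 \<in> int_polys K" "a3 \<in> int_polys K" "a4 \<in> int_polys K"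
    and "m mod l = n mod l"
    and "poly_cong K l (qpoly a1 a2 a3 a4 m) (qpoly a1 a2 a3 a4 n)"
    and "poly_cong K l (qpoly a1 a2 a3 a4 (Suc m)) (qpoly a1 a2 a3 a4 (Suc n))"
  shows "poly_cong K l (qpoly a1 a2 a3 a4 (Suc (Suc m))) (qpoly a1 a2 a3 a4 (Suc (Suc n)))"
proof -
  have Suc: "Suc m mod l = Suc n mod l"
    using assms(6) by (metis mod_Suc_eq)
  hence "(Suc m + 11) mod l = (Suc n + 11) mod l"
    by (metis mod_add_left_eq)
  with Suc have "Suc m * (Suc m + 11) mod l = Suc n * (Suc n + 11) mod l"
    by (metis mod_mult_eq)
  with Suc show ?thesis
    unfolding qpoly.simps Let_def
    using assms(7,8) by (intro poly_cong_add poly_cong_mult poly_cong_pderiv poly_cong_of_nat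
        poly_cong_refl K a)
qed

theorem theorem6p1:
  fixes D :: int and K :: "complex set" and a1 a2 a3 a4 :: "complex poly" and l :: nat
    and s :: "nat \<Rightarrow> complex set"
  assumes "D < 0" "fundamental_discriminant D"
    and "cm_data D K a1 a2 a3 a4"
    and "l \<ge> 1"
    and "s = (\<lambda>m. cong_rel K l `` {poly (qpoly a1 a2 a3 a4 m) 0})"
  shows "eventually_periodic s \<and>
         (\<forall>\<alpha> \<beta>. preperiod_and_period s \<alpha> \<beta> \<longrightarrow>
           \<alpha> + \<beta> \<le> l * card (residue_ring_of_ints K l) ^ (2 * l))"
proof -
  note int = cm_data_integral[OF assms(3)]
  let ?q = "qpoly a1 a2 a3 a4" and ?R = "residue_ring_of_ints K l"
  define trunc where "trunc p = (\<lambda>i\<in>{..<l}. cong_rel K l `` {Polynomial.coeff p i})" for p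
  define \<sigma> where "\<sigma> n = (n mod l, trunc (?q n), trunc (?q (Suc n)))" for n
  define X where "X = {..<l} \<times> (PiE {..<l} (\<lambda>_. ?R)) \<times> (PiE {..<l} (\<lambda>_. ?R))"
  have q: "?q n \<in> int_polys K" for n
    using int by (rule qpoly_int)
  have \<sigma>_eq: "\<sigma> m = \<sigma> n \<longleftrightarrow> m mod l = n mod l \<and>
      poly_cong K l (?q m) (?q n) \<and> poly_cong K l (?q (Suc m)) (?q (Suc n))" for m n
    using poly_cong_trunc_eq_iff[OF int(1) q q] by (simp add: \<sigma>_def trunc_def)
  have fin: "finite ?R"
    using finite_residue_ring_of_ints[OF int(1)] assms(4) by simp
  have "\<exists>a p. periodic_from s a p \<and> a + p \<le> card X"
  proof (rule finite_state_periodic)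
    show "finite X" unfolding X_def using fin by (intro finite_cartesian_product finite_PiE) auto
    have "trunc (?q n) \<in> PiE {..<l} (\<lambda>_. ?R)" for n
      using q[of n] by (auto simp: trunc_def residue_ring_of_ints_def int_polys_def intro: quotientI)
    thus "\<sigma> n \<in> X" for n
      using assms(4) by (simp add: \<sigma>_def X_def)
    show "\<sigma> (Suc m) = \<sigma> (Suc n)" if "\<sigma> m = \<sigma> n" for m n
      using that poly_cong_qpoly_step[OF int, of m l n] unfolding \<sigma>_eq by (metis mod_Suc_eq)
    show "s m = s n" if "\<sigma> m = \<sigma> n" for m n
    proof -
      have "poly_cong K l (?q m) (?q n)" using that \<sigma>_eq by blast
      \<comment> \<open>The value at 0 is the coefficient of index 0, which is controlled because
        \<open>l \<ge> 1\<close>.\<close>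
      hence "(Polynomial.coeff (?q m) 0, Polynomial.coeff (?q n) 0) \<in> cong_rel K l"
        using assms(4) by (simp add: poly_cong_def)
      thus ?thesis
        using equiv_class_eq[OF equiv_cong_rel[OF int(1)]] by (simp add: assms(5) poly_0_coeff_0)
    qed
  qed
  then obtain a p where ap: "periodic_from s a p" "a + p \<le> card X" by blast
  have "card X = l * (card ?R ^ l * card ?R ^ l)"
    by (simp add: X_def card_cartesian_product card_PiE)
  hence X: "card X = l * card ?R ^ (2 * l)"
    by (simp add: mult_2 power_add)
  \<comment> \<open>The pair \<open>a\<close>, \<open>p\<close> found by repetition need not be the
    least one, but it bounds \<alpha> and \<beta> separately.\<close>
  have "\<alpha> + \<beta> \<le> l * card ?R ^ (2 * l)" if "preperiod_and_period s \<alpha> \<beta>" for \<alpha> \<beta>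
    using least_period_le[OF that ap(1)] ap(2) X by linarith
  thus ?thesis using ap(1) unfolding eventually_periodic_def by blast
qed

end
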